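(* For each $n$ let $A_n=[a^{(n)}_{i,j}]\in M_n(\mathbb C)$ be a self-adjoint matrix with zero diagonal, such that the entries are uniformly bounded, $\sup_{i,j,n}|a^{(n)}_{i,j}|<\infty$, and such that the matrix $\frac1nA_n$ has limit distribution $\mu$ with respect to the state $\omega$. Let $X_1,\dots,X_n$ (whose common distribution may depend on $n$) be identically distributed Boolean independent random variables with mean $\varphi(X_i)=\frac1{\sqrt n}$ and variance equal to $1$. Additionally, let the Boolean cumulants satisfy the product formula: for all $r,m\in\mathbb N$, $i_1<i_2<\dots<i_r=m$, $\rho=\{(1,\dots,i_1),(i_1+1,\dots,i_2),\dots,(i_{r-1}+1,\dots,i_r)\}\in\mathcal I(m)$ and all $Y_1,\dots,Y_m\in\mathcal A$, $$K_r(Y_1\cdots Y_{i_1},\dots,Y_{i_{r-1}+1}\cdots Y_m)=\sum_{\substack{\pi\in\mathcal I(m)\\ \pi\vee\rho=\hat1_m}}K_\pi(Y_1,\dots,Y_m).$$ Then the sequence of quadratic forms $$Q_n=\frac1n\sum_{\substack{i,j=1\\ i\ne j}}^n a^{(n)}_{i,j}X_iX_j$$ converges in distribution to $Y$, where for all $r\in\mathbb N$ $$K_r(Y)=\int t^r\,d\mu(t).$$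
   Context: A noncommutative probability space is a pair $(\mathcal A,\varphi)$ with $\mathcal A$ a unital $*$-algebra and $\varphi:\mathcal A\to\mathbb C$ a normal state; random variables are self-adjoint elements of $\mathcal A$. Subalgebras $(\mathcal A_i)_{i\in I}$ are Boolean independent if $\varphi(X_1\cdots X_m)=\varphi(X_1)\cdots\varphi(X_m)$ whenever $X_j\in\mathcal A_{i(j)}$ with $i(1)\ne i(2)\ne\dots\ne i(m)$ (consecutive indices distinct); random variables are Boolean independent if the (not necessarily unital) subalgebras they generate are. $\mathcal I(n)$ is the lattice (under refinement, $\pi\le\rho$ if every block of $\pi$ is contained in a block of $\rho$) of interval partitions of $\{1,\dots,n\}$ (every block consists of consecutive integers), with maximal element $\hat1_n$ (one block). The Boolean cumulants are the multilinear functionals $K_n:\mathcal A^n\to\mathbb C$ defined recursively by $\varphi(X_1\cdots X_n)=\sum_{\pi\in\mathcal I(n)}K_\pi(X_1,\dots,X_n)$, where $K_\pi(X_1,\dots,X_n)=\prod_{B\in\pi}K_{|B|}(X_i:i\in B)$; write $K_n(X)=K_n(X,\dots,X)$. The mean is $K_1(X)=\varphi(X)$ and the variance is $K_2(X)$. "Identically distributed" means: $K_r(X_1)=\dots=K_r(X_n)$ for all $r\in\mathbb N$ (these values may depend on $n$), and $|K_r(X_i)|<C_r$ with constants $C_r$ independent of $n$. Let $J_n$ be the $n\times n$ all-ones matrix and $P_n=\frac1nJ_n$. The state $\omega$ on $M_n(\mathbb C)$ is $\omega(C)=\mathrm{Tr}(P_nC)=\frac1n\sum_{i,j}c_{ij}$.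 A sequence of $N\times N$ matrices $B_N$ has limit distribution $\mu$ with respect to $\omega$ if $\lim_{N\to\infty}\omega(B_N^m)=\int t^m\,d\mu(t)$ for every $m\in\mathbb N$ ($\mu$ is not necessarily a probability measure). Convergence in distribution $X_n\to X$ means $\lim_n\varphi(X_n^m)=\varphi(X^m)$ for all $m\in\mathbb N$, equivalently $\lim_nK_m(X_n)=K_m(X)$ for all $m$. *)

theory Defs
  imports
    "HOL-Analysis.Analysis"
    "HOL-Library.Disjoint_Sets"
    "HOL-Computational_Algebra.Polynomial"
    "Jordan_Normal_Form.Matrix"
    "Jordan_Normal_Form.Schur_Decomposition"
begin

section \<open>Noncommutative probability spaces\<close>

locale star_algebra = vector_space cscale
  for cscale :: "complex \<Rightarrow> 'a::ring_1 \<Rightarrow> 'a" +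
  fixes star :: "'a \<Rightarrow> 'a"
  assumes cscale_mult_left: "cscale c x * y = cscale c (x * y)"
    and cscale_mult_right: "x * cscale c y = cscale c (x * y)"
    and star_add: "star (x + y) = star x + star y"
    and star_cscale: "star (cscale c x) = cscale (cnj c) (star x)"
    and star_mult: "star (x * y) = star y * star x"
    and star_star: "star (star x) = x"
begin

definition self_adjoint :: "'a \<Rightarrow> bool" where
  "self_adjoint x \<longleftrightarrow> star x = x"

definition positive :: "'a \<Rightarrow> bool" where
  "positive x \<longleftrightarrow> (\<exists>ys. x = (\<Sum>y\<leftarrow>ys. star y * y))"

definition below :: "'a \<Rightarrow> 'a \<Rightarrow> bool" where
  "below x y \<longleftrightarrow> positive (y - x)"

definition is_supremum :: "'a set \<Rightarrow> 'a \<Rightarrow> bool" where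
  "is_supremum D s \<longleftrightarrow> self_adjoint s \<and> (\<forall>d\<in>D. below d s) \<and>
     (\<forall>t. self_adjoint t \<and> (\<forall>d\<in>D. below d t) \<longrightarrow> below s t)"

text \<open>
  A bare *-algebra carries no ultraweak topology, so normality is expressed through the order
  whose positive cone consists of the finite sums of elements \<open>star y * y\<close>: a normal functional
  preserves suprema of upward directed sets of self-adjoint elements. On a von Neumann algebra
  and for a state this is the usual notion.
\<close>

definition normal :: "('a \<Rightarrow> complex) \<Rightarrow> bool" where
  "normal \<phi> \<longleftrightarrow> (\<forall>D s. D \<noteq> {} \<and> (\<forall>d\<in>D. self_adjoint d) \<and>
      (\<forall>a\<in>D. \<forall>b\<in>D. \<exists>c\<in>D. below a c \<and> below b c) \<and> is_supremum D s \<longrightarrow>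
      (SUP d\<in>D. Re (\<phi> d)) = Re (\<phi> s))"

end

text \<open>The order on \<^typ>\<open>complex\<close> is that of \<^theory>\<open>HOL-Library.Complex_Order\<close>:
  \<open>0 \<le> z\<close> says that \<open>z\<close> is a nonnegative real number.\<close>

locale nc_probability_space = star_algebra cscale star
  for cscale :: "complex \<Rightarrow> 'a::ring_1 \<Rightarrow> 'a" and star :: "'a \<Rightarrow> 'a" +
  fixes \<phi> :: "'a \<Rightarrow> complex"
  assumes state_linear: "Vector_Spaces.linear cscale (*) \<phi>"
    and state_positive: "0 \<le> \<phi> (star x * x)"
    and state_one: "\<phi> 1 = 1"
    and state_normal: "normal \<phi>"
begin

definition random_variable :: "'a \<Rightarrow> bool" where
  "random_variable x \<longleftrightarrow> self_adjoint x"

end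


section \<open>Boolean independence\<close>

definition nonunital_subalgebra :: "(complex \<Rightarrow> 'a::ring_1 \<Rightarrow> 'a) \<Rightarrow> 'a set \<Rightarrow> bool" where
  "nonunital_subalgebra cscale S \<longleftrightarrow>
     module.subspace cscale S \<and> (\<forall>x\<in>S. \<forall>y\<in>S. x * y \<in> S)"

definition boolean_independent_sets ::
    "('a::ring_1 \<Rightarrow> complex) \<Rightarrow> 'i set \<Rightarrow> ('i \<Rightarrow> 'a set) \<Rightarrow> bool" where
  "boolean_independent_sets \<phi> I \<A> \<longleftrightarrow>
     (\<forall>is xs. length xs = length is \<and> set is \<subseteq> I \<and> distinct_adj is \<and>
        (\<forall>j<length is. xs ! j \<in> \<A> (is ! j)) \<longrightarrow>
        \<phi> (prod_list xs) = prod_list (map \<phi> xs))"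

definition boolean_independent ::
    "(complex \<Rightarrow> 'a::ring_1 \<Rightarrow> 'a) \<Rightarrow> ('a \<Rightarrow> complex) \<Rightarrow> 'i set \<Rightarrow> ('i \<Rightarrow> 'a) \<Rightarrow> bool" where
  "boolean_independent cscale \<phi> I X \<longleftrightarrow>
     boolean_independent_sets \<phi> I (\<lambda>i. nonunital_subalgebra cscale hull {X i})"


section \<open>Interval partitions and Boolean cumulants\<close>

text \<open>Positions are counted from 0, as in lists: partitions of \<open>{1,\<dots>,n}\<close> become partitions of
  \<open>{..<n}\<close>, and \<open>nths xs B\<close> is the tuple of the entries of \<open>xs\<close> at the positions in \<open>B\<close>.\<close>

definition interval_partitions :: "nat \<Rightarrow> nat set set set" where
  "interval_partitions n = {\<pi>. partition_on {..<n} \<pi> \<and> (\<forall>B\<in>\<pi>. \<exists>a b. B = {a..<b})}"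

definition top_partition :: "nat \<Rightarrow> nat set set" where
  "top_partition n = {{..<n}}"

definition interval_join :: "nat \<Rightarrow> nat set set \<Rightarrow> nat set set \<Rightarrow> nat set set" where
  "interval_join n \<pi> \<rho> = (THE \<sigma>. \<sigma> \<in> interval_partitions n \<and>
     refines {..<n} \<pi> \<sigma> \<and> refines {..<n} \<rho> \<sigma> \<and>
     (\<forall>\<tau>\<in>interval_partitions n.
        refines {..<n} \<pi> \<tau> \<and> refines {..<n} \<rho> \<tau> \<longrightarrow> refines {..<n} \<sigma> \<tau>))"

lemma length_nths_interval_partition:
  assumes "\<pi> \<in> interval_partitions (length xs) - {top_partition (length xs)}" "B \<in> \<pi>"
  shows "length (nths xs B) < length xs"
proof -
  let ?n = "length xs"
  have p: "partition_on {..<?n} \<pi>" and ne: "\<pi> \<noteq> {{..<?n}}"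
    using assms(1) by (auto simp: interval_partitions_def top_partition_def)
  have sub: "B \<subseteq> {..<?n}"
    using p assms(2) by (auto simp: partition_on_def)
  have "B \<noteq> {..<?n}"
  proof
    assume B: "B = {..<?n}"
    have "C = B" if "C \<in> \<pi>" for C
    proof (rule ccontr)
      assume "C \<noteq> B"
      then have "C \<inter> B = {}"
        using p that assms(2) by (auto simp: partition_on_def disjoint_def)
      moreover have "C \<subseteq> B" "C \<noteq> {}"
        using p that B by (auto simp: partition_on_def)
      ultimately show False by blast
    qed
    then have "\<pi> = {B}" using assms(2) by blast
    then show False using ne B by simp
  qed
  with sub have "B \<subset> {..<?n}" by blast
  then have "card B < ?n"
    by (metis card_lessThan finite_lessThan psubset_card_mono)
  moreover have "{i. i < ?n \<and> i \<in> B} = B" using sub by auto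
  ultimately show ?thesis by (simp add: length_nths)
qed

text \<open>The moment-cumulant formula, solved for the term of the one-block partition; the formula
  itself is lemma \<open>moment_cumulant_formula\<close> below.\<close>

function boolean_cumulant :: "('a::monoid_mult \<Rightarrow> complex) \<Rightarrow> 'a list \<Rightarrow> complex" where
  "boolean_cumulant \<phi> xs = \<phi> (prod_list xs) -
     (\<Sum>\<pi>\<in>interval_partitions (length xs) - {top_partition (length xs)}.
        \<Prod>B\<in>\<pi>. boolean_cumulant \<phi> (nths xs B))"
  by pat_completeness auto
termination
  by (relation "Wellfounded.measure (\<lambda>(\<phi>, xs). length xs)") (simp_all add: length_nths_interval_partition)

declare boolean_cumulant.simps [simp del]

definition partitioned_cumulant ::
    "('a::monoid_mult \<Rightarrow> complex) \<Rightarrow> nat set set \<Rightarrow> 'a list \<Rightarrow> complex" where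
  "partitioned_cumulant \<phi> \<pi> xs = (\<Prod>B\<in>\<pi>. boolean_cumulant \<phi> (nths xs B))"

lemma finite_interval_partitions: "finite (interval_partitions n)"
proof (rule finite_subset)
  show "interval_partitions n \<subseteq> Pow (Pow {..<n})"
    by (auto simp: interval_partitions_def partition_on_def)
qed simp

lemma top_partition_in: "n > 0 \<Longrightarrow> top_partition n \<in> interval_partitions n"
  by (auto simp: interval_partitions_def top_partition_def partition_on_def disjoint_def
      lessThan_atLeast0)

theorem moment_cumulant_formula:
  assumes "xs \<noteq> []"
  shows "\<phi> (prod_list xs) =
    (\<Sum>\<pi>\<in>interval_partitions (length xs). partitioned_cumulant \<phi> \<pi> xs)"
proof -
  have top: "partitioned_cumulant \<phi> (top_partition (length xs)) xs = boolean_cumulant \<phi> xs"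
    by (simp add: partitioned_cumulant_def top_partition_def nths_all)
  show ?thesis
    using assms boolean_cumulant.simps[of \<phi> xs] top
    by (simp add: sum.remove[OF finite_interval_partitions top_partition_in]
        flip: partitioned_cumulant_def)
qed

definition univariate_cumulant :: "('a::monoid_mult \<Rightarrow> complex) \<Rightarrow> nat \<Rightarrow> 'a \<Rightarrow> complex" where
  "univariate_cumulant \<phi> r x = boolean_cumulant \<phi> (replicate r x)"

text \<open>The blocks of \<open>\<rho>\<close> are \<open>{i k..<i (k + 1)}\<close> for \<open>k < r\<close>, with the convention \<open>i 0 = 0\<close>.\<close>

definition product_formula :: "('a::monoid_mult \<Rightarrow> complex) \<Rightarrow> bool" where
  "product_formula \<phi> \<longleftrightarrow>
     (\<forall>r m i ys. r \<ge> 1 \<and> i 0 = 0 \<and> strict_mono_on {0..r} i \<and> i r = m \<and> length ys = m \<longrightarrow>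
        (let \<rho> = (\<lambda>k. {i k..<i (Suc k)}) ` {..<r} in
          boolean_cumulant \<phi> (map (\<lambda>k. prod_list (nths ys {i k..<i (Suc k)})) [0..<r]) =
          (\<Sum>\<pi> | \<pi> \<in> interval_partitions m \<and> interval_join m \<pi> \<rho> = top_partition m.
             partitioned_cumulant \<phi> \<pi> ys)))"


section \<open>Triangular arrays and convergence in distribution\<close>

text \<open>Row \<open>n\<close> of the array consists of \<open>X n 0, \<dots>, X n (n - 1)\<close>.\<close>

definition identically_distributed ::
    "('a::monoid_mult \<Rightarrow> complex) \<Rightarrow> (nat \<Rightarrow> nat \<Rightarrow> 'a) \<Rightarrow> bool" where
  "identically_distributed \<phi> X \<longleftrightarrow>
     (\<forall>n. \<forall>i<n. \<forall>j<n. \<forall>r\<ge>1. univariate_cumulant \<phi> r (X n i) = univariate_cumulant \<phi> r (X n j)) \<and>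
     (\<exists>C :: nat \<Rightarrow> real. \<forall>n. \<forall>i<n. \<forall>r\<ge>1. cmod (univariate_cumulant \<phi> r (X n i)) < C r)"

text \<open>Convergence in moments. The limit variable may live in a space other than that of the sequence.
  To assert that a limit exists, some carrier has to be named, since HOL has no quantification over
  types. Polynomials suffice: the distribution of a random variable is a functional on them.\<close>

definition converges_in_distribution ::
    "('a::monoid_mult \<Rightarrow> complex) \<Rightarrow> (nat \<Rightarrow> 'a) \<Rightarrow> ('b::monoid_mult \<Rightarrow> complex) \<Rightarrow> 'b \<Rightarrow> bool" where
  "converges_in_distribution \<phi> Z \<psi> Y \<longleftrightarrow> (\<forall>m\<ge>1. (\<lambda>n. \<phi> (Z n ^ m)) \<longlonglongrightarrow> \<psi> (Y ^ m))"


section \<open>Matrices and the state \<open>\<omega>\<close>\<close>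

definition mat_trace :: "complex mat \<Rightarrow> complex" where
  "mat_trace C = (\<Sum>i<dim_row C. C $$ (i, i))"

definition J_mat :: "nat \<Rightarrow> complex mat" where
  "J_mat n = Matrix.mat n n (\<lambda>_. 1)"

definition P_mat :: "nat \<Rightarrow> complex mat" where
  "P_mat n = (1 / of_nat n) \<cdot>\<^sub>m J_mat n"

definition \<omega> :: "nat \<Rightarrow> complex mat \<Rightarrow> complex" where
  "\<omega> n C = mat_trace (P_mat n * C)"

text \<open>Only the moments of order at least 1 are involved, so the total mass of \<open>\<mu>\<close> is not
  prescribed.\<close>

definition has_limit_distribution :: "(nat \<Rightarrow> complex mat) \<Rightarrow> real measure \<Rightarrow> bool" where
  "has_limit_distribution B \<mu> \<longleftrightarrow> sets \<mu> = sets borel \<and>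
     (\<forall>m\<ge>1. integrable \<mu> (\<lambda>t. t ^ m) \<and>
        (\<lambda>N. \<omega> N (B N ^\<^sub>m m)) \<longlonglongrightarrow> complex_of_real (\<integral>t. t ^ m \<partial>\<mu>))"

definition quadratic_form ::
    "(complex \<Rightarrow> 'a::ring_1 \<Rightarrow> 'a) \<Rightarrow> nat \<Rightarrow> complex mat \<Rightarrow> (nat \<Rightarrow> 'a) \<Rightarrow> 'a" where
  "quadratic_form cscale n A X = cscale (1 / of_nat n)
     (\<Sum>(i, j)\<in>{(i, j). i < n \<and> j < n \<and> i \<noteq> j}. cscale (A $$ (i, j)) (X i * X j))"

end

theory Submission
  imports Defs "HOL-Computational_Algebra.Fundamental_Theorem_Algebra"
begin

text \<open>
  Write \<open>B = A\<^sub>n / n\<close> and \<open>P = J\<^sub>n / n\<close>. The idea is that the moments of the quadratic form can be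
  computed exactly for every \<open>n\<close>. In the expansion of \<open>Q\<^sub>n ^ m\<close> the two factors \<open>X i * X k\<close> of one
  summand have different indices, so Boolean independence cuts every word between them: what is
  left are the two outer means and, between consecutive summands, the factors \<open>\<phi> (X k * X i)\<close>.
  With mean \<open>1 / sqrt n\<close> and variance 1 these form the matrix \<open>I + P\<close>, whence
  \<open>\<phi> (Q\<^sub>n ^ m) = \<omega> (B (I + P) B \<dots> (I + P) B)\<close>. The matrix \<open>P\<close> is the rank one projection that defines
  \<open>\<omega>\<close>, so choosing \<open>P\<close> in a bracket splits the product into two factors under \<open>\<omega>\<close>. Sorting by the
  first bracket in which \<open>P\<close> is chosen gives
  \<open>\<phi> (Q\<^sub>n ^ (m + 1)) = (\<Sum>r\<le>m. \<omega> (B ^ (r + 1)) * \<phi> (Q\<^sub>n ^ (m - r)))\<close>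
  (lemma \<open>quadratic_form_moment_recursion\<close>). This is the Boolean moment-cumulant recursion sorted by
  the first block of the interval partition (lemma \<open>moment_first_block\<close>): the Boolean cumulants of
  \<open>Q\<^sub>n\<close> are exactly the \<open>\<omega>\<close>-moments of \<open>B\<close>. Letting \<open>n\<close> tend to infinity, the moments
  converge, and the limits obey the same recursion with the moments of \<open>\<mu>\<close> as cumulants.

  The limit variable is the indeterminate of \<open>\<complex>[t]\<close> under the functional that has the limit
  moments. This functional is positive because it is a limit of restrictions of a state to the
  algebras generated by the self-adjoint \<open>Q\<^sub>n\<close>. Normality holds for every positive functional on
  \<open>\<complex>[t]\<close> (lemma \<open>positive_functional_normal\<close>): above a fixed element, a directed set of polynomials
  with an upper bound lives in a space of polynomials of bounded degree, where pointwise limits are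
  again polynomials and every functional is continuous.
\<close>

section \<open>The moment-cumulant formula sorted by the first block\<close>

text \<open>An interval partition is its first block, which has the form \<open>{..<j}\<close>, together with
  an interval partition of the remaining positions, shifted by \<open>j\<close>.\<close>

lemma bij_betw_interval_partitions_first_block:
  assumes "n > 0"
  shows "bij_betw (\<lambda>(j, \<pi>). insert {..<j} ((`) ((+) j) ` \<pi>))
     (SIGMA j:{1..n}. interval_partitions (n - j)) (interval_partitions n)"
proof (rule bij_betwI')
  fix x y
  assume x: "x \<in> (SIGMA j:{1..n}. interval_partitions (n - j))"
    and y: "y \<in> (SIGMA j:{1..n}. interval_partitions (n - j))"
  obtain j \<pi> k \<sigma> where xy: "x = (j, \<pi>)" "y = (k, \<sigma>)"
    by (metis surj_pair)
  have j: "1 \<le> j" "1 \<le> k" using x y xy by auto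
  have eq: "j = k \<and> \<pi> = \<sigma>"
    if h: "insert {..<j} ((`) ((+) j) ` \<pi>) = insert {..<k} ((`) ((+) k) ` \<sigma>)"
  proof -
    have z: "0 \<notin> C" if "C \<in> (`) ((+) i) ` \<tau>" "1 \<le> i" for C i and \<tau> :: "nat set set"
      using that by auto
    have "{..<j} \<in> insert {..<k} ((`) ((+) k) ` \<sigma>)"
      using h by blast
    moreover have "0 \<in> {..<j}" using j by simp
    ultimately have "{..<j} = {..<k}" using z[of _ k] j by blast
    then have jk: "j = k" by simp
    have "{..<j} \<notin> (`) ((+) j) ` \<tau>" for \<tau>
      using z[of "{..<j}" j] j by auto
    then have "(`) ((+) j) ` \<pi> = (`) ((+) j) ` \<sigma>"
      using h jk by (metis insert_ident)
    moreover have "inj ((`) ((+) j))"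
      by (rule injI) (simp add: inj_image_eq_iff)
    ultimately show ?thesis using jk by (simp add: inj_image_eq_iff)
  qed
  show "((case x of (j, \<pi>) \<Rightarrow> insert {..<j} ((`) ((+) j) ` \<pi>)) =
      (case y of (j, \<pi>) \<Rightarrow> insert {..<j} ((`) ((+) j) ` \<pi>))) = (x = y)"
    using eq xy by auto
next
  fix x
  assume x: "x \<in> (SIGMA j:{1..n}. interval_partitions (n - j))"
  obtain j \<pi> where xy: "x = (j, \<pi>)" "1 \<le> j" "j \<le> n" and p: "\<pi> \<in> interval_partitions (n - j)"
    using x by auto
  have p1: "\<Union>\<pi> = {..<n - j}" "disjoint \<pi>" "{} \<notin> \<pi>" "\<And>B. B \<in> \<pi> \<Longrightarrow> \<exists>a b. B = {a..<b}"
    using p by (auto simp: interval_partitions_def partition_on_def)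
  have "\<Union>((`) ((+) j) ` \<pi>) = (+) j ` \<Union>\<pi>" by blast
  also have "\<dots> = {j..<n}"
    using xy by (simp add: p1 lessThan_atLeast0 image_add_atLeastLessThan)
  finally have U: "\<Union>((`) ((+) j) ` \<pi>) = {j..<n}" .
  have "partition_on {..<n} (insert {..<j} ((`) ((+) j) ` \<pi>))"
  proof (rule partition_onI)
    show "\<Union>(insert {..<j} ((`) ((+) j) ` \<pi>)) = {..<n}"
      using U xy by auto
    show "disjnt p q" if pq: "p \<in> insert {..<j} ((`) ((+) j) ` \<pi>)"
      "q \<in> insert {..<j} ((`) ((+) j) ` \<pi>)" "p \<noteq> q" for p q
    proof -
      have "disjnt ((+) j ` B) ((+) j ` C)" if "B \<in> \<pi>" "C \<in> \<pi>" "B \<noteq> C" for B C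
        using p1(2) that by (force simp: disjoint_def disjnt_def)
      moreover have "disjnt {..<j} ((+) j ` C)" "disjnt ((+) j ` C) {..<j}" for C
        by (auto simp: disjnt_def)
      ultimately show ?thesis using pq by auto
    qed
    have "0 \<in> {..<j}" using xy by simp
    then show "{} \<notin> insert {..<j} ((`) ((+) j) ` \<pi>)"
      using p1(3) by blast
  qed
  moreover have "\<exists>a b. B = {a..<b}" if B: "B \<in> insert {..<j} ((`) ((+) j) ` \<pi>)" for B
  proof (cases "B = {..<j}")
    case True
    then show ?thesis by (auto simp: lessThan_atLeast0)
  next
    case False
    then obtain C where C: "C \<in> \<pi>" "B = (+) j ` C" using B by blast
    obtain a b where "C = {a..<b}" using p1(4)[OF C(1)] by blast
    then show ?thesis using C(2) by (auto simp: image_add_atLeastLessThan)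
  qed
  ultimately show "(case x of (j, \<pi>) \<Rightarrow> insert {..<j} ((`) ((+) j) ` \<pi>)) \<in> interval_partitions n"
    using xy by (auto simp: interval_partitions_def)
next
  fix \<rho> assume r: "\<rho> \<in> interval_partitions n"
  have r1: "\<Union>\<rho> = {..<n}" "disjoint \<rho>" "{} \<notin> \<rho>" "\<And>B. B \<in> \<rho> \<Longrightarrow> \<exists>a b. B = {a..<b}"
    using r by (auto simp: interval_partitions_def partition_on_def)
  obtain B where B: "B \<in> \<rho>" "0 \<in> B" using r1(1) assms by blast
  obtain j where Bj: "B = {..<j}" "1 \<le> j"
  proof -
    obtain a b where "B = {a..<b}" using r1(4)[OF B(1)] by blast
    then show thesis using B(2) that[of b] by (auto simp: lessThan_atLeast0)
  qed
  have jn: "j \<le> n" using B(1) Bj(1) r1(1) by (metis Union_upper lessThan_subset_iff)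
  \<comment> \<open>Every block other than \<open>B\<close> lies to the right of \<open>B\<close>, so shifting back by \<open>j\<close> loses nothing.\<close>
  define \<pi> where "\<pi> = {C. (+) j ` C \<in> \<rho>}"
  have ge: "\<exists>C'. C = (+) j ` C'" if "C \<in> \<rho>" "C \<noteq> B" for C
  proof -
    have "C \<inter> B = {}" using r1(2) that B(1) by (auto simp: disjoint_def)
    then have "j \<le> x" if "x \<in> C" for x using that Bj by force
    then have "(+) j ` ((\<lambda>x. x - j) ` C) = (\<lambda>x. x) ` C"
      unfolding image_image by (intro image_cong) auto
    then show ?thesis by (metis image_ident)
  qed
  have eq: "\<rho> = insert {..<j} ((`) ((+) j) ` \<pi>)"
  proof (intro equalityI subsetI)
    fix C assume C: "C \<in> \<rho>"
    show "C \<in> insert {..<j} ((`) ((+) j) ` \<pi>)"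
    proof (cases "C = B")
      case False
      then obtain C' where "C = (+) j ` C'" using ge C by blast
      then show ?thesis using C by (simp add: \<pi>_def)
    qed (simp add: Bj)
  qed (use B Bj in \<open>auto simp: \<pi>_def\<close>)
  have "\<pi> \<in> interval_partitions (n - j)"
    unfolding interval_partitions_def
  proof (intro CollectI conjI ballI partition_onI)
    show "\<Union>\<pi> = {..<n - j}"
    proof (intro equalityI subsetI)
      fix x assume "x \<in> \<Union>\<pi>"
      then have "j + x \<in> \<Union>\<rho>" by (auto simp: \<pi>_def)
      then show "x \<in> {..<n - j}" using r1(1) by auto
    next
      fix x assume "x \<in> {..<n - j}"
      then have "j + x \<in> \<Union>\<rho>" using r1(1) by auto
      then obtain C where C: "C \<in> \<rho>" "j + x \<in> C" by blast
      then have "C \<noteq> B" using Bj by auto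
      then obtain C' where "C = (+) j ` C'" using ge C by blast
      then show "x \<in> \<Union>\<pi>" using C by (auto simp: \<pi>_def)
    qed
    show "disjnt p q" if "p \<in> \<pi>" "q \<in> \<pi>" "p \<noteq> q" for p q
    proof -
      have "(+) j ` p \<noteq> (+) j ` q" using that by (simp add: inj_image_eq_iff)
      then have "(+) j ` p \<inter> (+) j ` q = {}"
        using r1(2) that by (auto simp: disjoint_def \<pi>_def)
      then show ?thesis by (auto simp: disjnt_def)
    qed
    show "{} \<notin> \<pi>" using r1(3) by (auto simp: \<pi>_def)
    show "\<exists>a b. C = {a..<b}" if C: "C \<in> \<pi>" for C
    proof -
      obtain a b where ab: "(+) j ` C = {a..<b}"
        using C r1(4)[of "(+) j ` C"] unfolding \<pi>_def by blast
      have "C = {a - j..<b - j}"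
      proof (intro equalityI subsetI)
        fix x assume "x \<in> C"
        then have "j + x \<in> {a..<b}" using ab by blast
        then show "x \<in> {a - j..<b - j}" by auto
      next
        fix x assume "x \<in> {a - j..<b - j}"
        then have "j + x \<in> {a..<b}" by auto
        then show "x \<in> C" using ab[symmetric] by auto
      qed
      then show ?thesis by blast
    qed
  qed
  then show "\<exists>x\<in>SIGMA j:{1..n}. interval_partitions (n - j).
      \<rho> = (case x of (j, \<pi>) \<Rightarrow> insert {..<j} ((`) ((+) j) ` \<pi>))"
    using eq Bj jn by (intro bexI[of _ "(j, \<pi>)"]) auto
qed

lemma sum_interval_partitions_first_block:
  fixes f :: "nat set \<Rightarrow> 'b::comm_semiring_1"
  assumes "n > 0"
  shows "(\<Sum>\<pi>\<in>interval_partitions n. \<Prod>B\<in>\<pi>. f B) =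
    (\<Sum>j=1..n. f {..<j} * (\<Sum>\<pi>\<in>interval_partitions (n - j). \<Prod>B\<in>\<pi>. f ((+) j ` B)))"
proof -
  have "(\<Sum>\<pi>\<in>interval_partitions n. \<Prod>B\<in>\<pi>. f B) =
    (\<Sum>(j, \<pi>)\<in>(SIGMA j:{1..n}. interval_partitions (n - j)).
       \<Prod>B\<in>insert {..<j} ((`) ((+) j) ` \<pi>). f B)"
    by (subst sum.reindex_bij_betw[OF bij_betw_interval_partitions_first_block[OF assms], symmetric])
       (simp add: case_prod_unfold)
  also have "\<dots> = (\<Sum>(j, \<pi>)\<in>(SIGMA j:{1..n}. interval_partitions (n - j)).
       f {..<j} * (\<Prod>B\<in>\<pi>. f ((+) j ` B)))"
  proof (rule sum.cong[OF refl], safe)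
    fix j \<pi> assume j: "j \<in> {1..n}" and p: "\<pi> \<in> interval_partitions (n - j)"
    have fin: "finite \<pi>"
      using p by (auto simp: interval_partitions_def intro: finite_elements)
    have "{..<j} \<notin> (`) ((+) j) ` \<pi>"
    proof
      assume "{..<j} \<in> (`) ((+) j) ` \<pi>"
      then have "0 \<in> {..<j} \<longrightarrow> (\<exists>x. 0 = j + x)" by auto
      then show False using j by auto
    qed
    moreover have "inj_on ((`) ((+) j)) \<pi>"
      by (rule inj_onI) (simp add: inj_image_eq_iff)
    ultimately show "(\<Prod>B\<in>insert {..<j} ((`) ((+) j) ` \<pi>). f B) = f {..<j} * (\<Prod>B\<in>\<pi>. f ((+) j ` B))"
      using fin by (simp add: prod.reindex)
  qed
  also have "\<dots> = (\<Sum>j=1..n. f {..<j} * (\<Sum>\<pi>\<in>interval_partitions (n - j). \<Prod>B\<in>\<pi>. f ((+) j ` B)))"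
    by (subst sum.Sigma[symmetric]) (auto simp: finite_interval_partitions sum_distrib_left)
  finally show ?thesis .
qed

lemma interval_partitions_0: "interval_partitions 0 = {{}}"
  by (auto simp: interval_partitions_def partition_on_empty)

text \<open>Summing over everything but the first block turns the tail of the moment-cumulant formula
  back into a moment. The condition \<open>\<phi> 1 = 1\<close> accounts for the partition whose only block is the
  first one, which leaves the empty product.\<close>

lemma moment_first_block:
  assumes "\<phi> 1 = 1" and "xs \<noteq> []"
  shows "\<phi> (prod_list xs) =
    (\<Sum>j=1..length xs. boolean_cumulant \<phi> (take j xs) * \<phi> (prod_list (drop j xs)))"
proof -
  have moment: "(\<Sum>\<pi>\<in>interval_partitions (length ys). \<Prod>B\<in>\<pi>. boolean_cumulant \<phi> (nths ys B))
      = \<phi> (prod_list ys)" for ys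
    using assms(1) moment_cumulant_formula[of ys \<phi>]
    by (cases "ys = []") (simp_all add: partitioned_cumulant_def interval_partitions_0)
  have "\<phi> (prod_list xs) =
      (\<Sum>j=1..length xs. boolean_cumulant \<phi> (nths xs {..<j}) *
        (\<Sum>\<pi>\<in>interval_partitions (length xs - j).
           \<Prod>B\<in>\<pi>. boolean_cumulant \<phi> (nths xs ((+) j ` B))))"
    using assms(2) by (subst moment[symmetric], subst sum_interval_partitions_first_block) auto
  also have "\<dots> = (\<Sum>j=1..length xs. boolean_cumulant \<phi> (take j xs) * \<phi> (prod_list (drop j xs)))"
    by (simp add: moment[symmetric] nths_drop)
  finally show ?thesis .
qed

text \<open>The first-block recursion is triangular with \<open>\<phi> 1 = 1\<close> in front of the newest cumulant, so
  it determines the cumulants: to identify them it suffices to exhibit numbers that satisfy it.\<close>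

lemma univariate_cumulant_unique:
  assumes one: "\<phi> 1 = 1"
    and rec: "\<And>m. \<phi> (y ^ Suc m) = (\<Sum>r\<le>m. k (Suc r) * \<phi> (y ^ (m - r)))"
    and "r \<ge> 1"
  shows "univariate_cumulant \<phi> r y = k r"
  using \<open>r \<ge> 1\<close>
proof (induction r rule: less_induct)
  case (less r)
  obtain m where r: "r = Suc m" using less.prems by (cases r) auto
  have "\<phi> (y ^ Suc m) = (\<Sum>j=1..Suc m. univariate_cumulant \<phi> j y * \<phi> (y ^ (Suc m - j)))"
    using moment_first_block[where \<phi> = \<phi> and xs = "replicate (Suc m) y", OF one]
    by (simp add: univariate_cumulant_def prod_list_replicate del: replicate_Suc power_Suc)
  also have "\<dots> = (\<Sum>r\<le>m. univariate_cumulant \<phi> (Suc r) y * \<phi> (y ^ (m - r)))"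
    by (simp only: One_nat_def sum.shift_bounds_cl_Suc_ivl atLeast0AtMost diff_Suc_Suc)
  also have "\<dots> = (\<Sum>r<m. k (Suc r) * \<phi> (y ^ (m - r))) + univariate_cumulant \<phi> (Suc m) y"
    using less.IH r one by (simp add: lessThan_Suc_atMost[symmetric])
  finally show ?case
    using rec[of m] r one by (simp add: lessThan_Suc_atMost[symmetric])
qed

section \<open>Moments of the quadratic form\<close>

context nc_probability_space
begin

interpretation state: Vector_Spaces.linear cscale "(*)" \<phi>
  by (rule state_linear)

text \<open>Boolean independence speaks of products whose consecutive factors come from different
  subalgebras. A word becomes such a product once each maximal run of equal letters is multiplied
  out.\<close>

lemma run_decomposition:
  assumes "w \<noteq> []"
  shows "\<exists>is ys. list_all2 (\<lambda>i y. y \<in> nonunital_subalgebra cscale hull {x i}) is ys \<and>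
    is \<noteq> [] \<and> set is \<subseteq> set w \<and> distinct_adj is \<and> hd is = hd w \<and> last is = last w \<and>
    prod_list ys = prod_list (map x w)"
  using assms
proof (induction w rule: list_nonempty_induct)
  case (single i)
  show ?case
    by (rule exI[of _ "[i]"], rule exI[of _ "[x i]"]) (simp add: hull_inc)
next
  case (cons i w)
  then obtain "is" ys where I: "list_all2 (\<lambda>i y. y \<in> nonunital_subalgebra cscale hull {x i}) is ys"
    "is \<noteq> []" "set is \<subseteq> set w" "distinct_adj is" "hd is = hd w" "last is = last w"
    "prod_list ys = prod_list (map x w)" by blast
  show ?case
  proof (cases "i = hd is")
    case True
    obtain y zs where ys: "ys = y # zs" using I(1,2) by (cases ys) auto
    have "y \<in> nonunital_subalgebra cscale hull {x i}"
      using I(1,2) ys True by (cases "is") auto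
    then have "x i * y \<in> nonunital_subalgebra cscale hull {x i}"
      by (auto simp: hull_def nonunital_subalgebra_def)
    then have "list_all2 (\<lambda>i y. y \<in> nonunital_subalgebra cscale hull {x i}) is ((x i * y) # zs)"
      using I(1,2) ys True by (cases "is") auto
    moreover have "prod_list ((x i * y) # zs) = prod_list (map x (i # w))"
      using I(7) ys by (simp add: mult.assoc)
    ultimately show ?thesis using I True cons.hyps
      by (intro exI[of _ "is"] exI[of _ "(x i * y) # zs"]) auto
  next
    case False
    then show ?thesis using I cons.hyps
      by (intro exI[of _ "i # is"] exI[of _ "x i # ys"])
         (auto simp: hull_inc distinct_adj_Cons)
  qed
qed

text \<open>If the letters at the junction differ, then no run crosses it and the runs of the two words
  together are the runs of the concatenation.\<close>

lemma state_mult_words: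
  assumes indep: "boolean_independent cscale \<phi> I x"
    and u: "u \<noteq> []" "set u \<subseteq> I" and v: "v \<noteq> []" "set v \<subseteq> I" and ne: "last u \<noteq> hd v"
  shows "\<phi> (prod_list (map x u) * prod_list (map x v)) =
    \<phi> (prod_list (map x u)) * \<phi> (prod_list (map x v))"
proof -
  obtain is1 ys1 where 1: "list_all2 (\<lambda>i y. y \<in> nonunital_subalgebra cscale hull {x i}) is1 ys1"
    "is1 \<noteq> []" "set is1 \<subseteq> set u" "distinct_adj is1" "last is1 = last u"
    "prod_list ys1 = prod_list (map x u)" using run_decomposition[OF u(1)] by blast
  obtain is2 ys2 where 2: "list_all2 (\<lambda>i y. y \<in> nonunital_subalgebra cscale hull {x i}) is2 ys2"
    "is2 \<noteq> []" "set is2 \<subseteq> set v" "distinct_adj is2" "hd is2 = hd v"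
    "prod_list ys2 = prod_list (map x v)" using run_decomposition[OF v(1)] by blast
  have factor: "\<phi> (prod_list ys) = prod_list (map \<phi> ys)"
    if "list_all2 (\<lambda>i y. y \<in> nonunital_subalgebra cscale hull {x i}) is ys"
      "set is \<subseteq> I" "distinct_adj is" for "is" ys
    using indep[unfolded boolean_independent_def boolean_independent_sets_def,
        THEN spec[of _ "is"], THEN spec[of _ ys]] that
    by (simp add: list_all2_conv_all_nth)
  have "\<phi> (prod_list (ys1 @ ys2)) = prod_list (map \<phi> (ys1 @ ys2))"
  proof (rule factor)
    show "list_all2 (\<lambda>i y. y \<in> nonunital_subalgebra cscale hull {x i}) (is1 @ is2) (ys1 @ ys2)"
      using 1(1) 2(1) by (rule list_all2_appendI)
    show "distinct_adj (is1 @ is2)"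
      using 1 2 ne by (auto simp: distinct_adj_append_iff)
  qed (use 1 2 u v in auto)
  then show ?thesis
    using factor[of is1 ys1] factor[of is2 ys2] 1 2 u v by auto
qed

text \<open>Factorization depends only on the first letter of the right factor. The span of all words
  with a given first letter carries it over to products with powers of the quadratic form.\<close>

definition word_span :: "'i set \<Rightarrow> ('i \<Rightarrow> 'a) \<Rightarrow> 'i \<Rightarrow> 'a set" where
  "word_span I x k = span {prod_list (map x v) |v. v \<noteq> [] \<and> set v \<subseteq> I \<and> hd v = k}"

lemma state_mult_word_span:
  assumes "boolean_independent cscale \<phi> I x"
    and "u \<noteq> []" "set u \<subseteq> I" "last u \<noteq> k" and y: "y \<in> word_span I x k"
  shows "\<phi> (prod_list (map x u) * y) = \<phi> (prod_list (map x u)) * \<phi> y"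
  using y unfolding word_span_def
proof (induction rule: span_induct_alt)
  case base
  then show ?case by (simp add: state.zero)
next
  case (step c z y)
  then obtain v where v: "z = prod_list (map x v)" "v \<noteq> []" "set v \<subseteq> I" "hd v = k" by blast
  have "\<phi> (prod_list (map x u) * z) = \<phi> (prod_list (map x u)) * \<phi> z"
    unfolding v(1) using assms v by (intro state_mult_words[where I = I]) auto
  then show ?case using step.IH
    by (simp add: distrib_left cscale_mult_right state.add state.scale)
qed

lemma word_span_mult:
  assumes y: "y \<in> word_span I x k" and "i \<in> I"
  shows "y * x i \<in> word_span I x k"
  using y unfolding word_span_def
proof (induction rule: span_induct_alt)
  case base
  then show ?case by (simp add: span_zero)
next
  case (step c z y)
  then obtain v where v: "z = prod_list (map x v)" "v \<noteq> []" "set v \<subseteq> I" "hd v = k" by blast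
  have "z * x i = prod_list (map x (v @ [i]))" using v by simp
  then have "z * x i \<in> span {prod_list (map x v) |v. v \<noteq> [] \<and> set v \<subseteq> I \<and> hd v = k}"
    using v \<open>i \<in> I\<close> by (intro span_base CollectI exI[of _ "v @ [i]"]) auto
  then show ?case using step.IH
    by (simp add: distrib_right cscale_mult_left span_add span_scale)
qed

lemma word_span_mult_quadratic_form:
  assumes "y \<in> word_span {..<n} x k"
  shows "y * quadratic_form cscale n A x ^ p \<in> word_span {..<n} x k"
proof (induction p)
  case 0
  then show ?case using assms by simp
next
  case (Suc p)
  let ?z = "y * quadratic_form cscale n A x ^ p"
  have "?z * x i * x j \<in> word_span {..<n} x k" if "i < n" "j < n" for i j
    using Suc that by (intro word_span_mult) auto
  then have "cscale (1 / of_nat n) (\<Sum>(i, j)\<in>{(i, j). i < n \<and> j < n \<and> i \<noteq> j}.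
      cscale (A $$ (i, j)) (?z * x i * x j)) \<in> word_span {..<n} x k"
    unfolding word_span_def by (intro span_scale span_sum) (auto intro: span_scale)
  also have "cscale (1 / of_nat n) (\<Sum>(i, j)\<in>{(i, j). i < n \<and> j < n \<and> i \<noteq> j}.
      cscale (A $$ (i, j)) (?z * x i * x j)) = ?z * quadratic_form cscale n A x"
    by (simp add: quadratic_form_def cscale_mult_right sum_distrib_left case_prod_unfold mult.assoc)
  also have "\<dots> = y * quadratic_form cscale n A x ^ Suc p"
    by (simp only: power_Suc2 mult.assoc)
  finally show ?case .
qed

text \<open>The vanishing diagonal lets the sum range over all pairs of indices, so that it becomes a
  matrix expression.\<close>

lemma state_quadratic_form_between:
  assumes diag: "\<And>i. i < n \<Longrightarrow> A $$ (i, i) = 0"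
  shows "\<phi> (z * quadratic_form cscale n A x * y) =
    (\<Sum>i<n. \<Sum>k<n. (1 / of_nat n * A $$ (i, k)) * \<phi> (z * x i * (x k * y)))"
proof -
  have "\<phi> (z * quadratic_form cscale n A x * y) =
    (\<Sum>(i, k)\<in>{(i, j). i < n \<and> j < n \<and> i \<noteq> j}. (1 / of_nat n * A $$ (i, k)) * \<phi> (z * x i * (x k * y)))"
    by (simp add: quadratic_form_def cscale_mult_right cscale_mult_left sum_distrib_left
        sum_distrib_right case_prod_unfold mult.assoc state.scale state.sum)
  also have "\<dots> = (\<Sum>(i, k)\<in>{..<n} \<times> {..<n}. (1 / of_nat n * A $$ (i, k)) * \<phi> (z * x i * (x k * y)))"
    using diag by (intro sum.mono_neutral_left) auto
  finally show ?thesis by (simp add: sum.cartesian_product)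
qed

lemma state_square:
  assumes "\<phi> x = c" "univariate_cumulant \<phi> 2 x = v"
  shows "\<phi> (x * x) = v + c\<^sup>2"
proof -
  have one: "boolean_cumulant \<phi> [x] = \<phi> x"
    using moment_first_block[where \<phi> = \<phi> and xs = "[x]", OF state_one] state_one by simp
  have "\<phi> (x * x) = boolean_cumulant \<phi> [x] * \<phi> x + boolean_cumulant \<phi> [x, x]"
    using moment_first_block[where \<phi> = \<phi> and xs = "[x, x]", OF state_one] state_one
    by (simp add: numeral_2_eq_2)
  then show ?thesis using assms one
    by (simp add: univariate_cumulant_def numeral_2_eq_2 power2_eq_square)
qed

end

lemma \<omega>_eq_mean_of_entries:
  assumes "C \<in> carrier_mat n n"
  shows "\<omega> n C = (\<Sum>j<n. \<Sum>k<n. C $$ (j, k)) / of_nat n"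
proof -
  have "\<omega> n C = (\<Sum>k<n. \<Sum>j<n. C $$ (j, k) / of_nat n)"
    using assms
    by (simp add: \<omega>_def mat_trace_def P_mat_def J_mat_def scalar_prod_def lessThan_atLeast0)
  then show ?thesis
    by (subst (asm) sum.swap) (simp add: sum_divide_distrib)
qed

lemma pow_mat_Suc_left:
  assumes "B \<in> carrier_mat n n"
  shows "B ^\<^sub>m Suc r = B * B ^\<^sub>m r"
proof (induction r)
  case 0
  then show ?case using assms by simp
next
  case (Suc r)
  have "B ^\<^sub>m Suc (Suc r) = (B * B ^\<^sub>m r) * B" using Suc by simp
  also have "\<dots> = B * (B ^\<^sub>m r * B)"
    by (rule assoc_mult_mat) (use assms in auto)
  finally show ?case by simp
qed

lemma row_sum_pow_mat_Suc:
  assumes B: "B \<in> carrier_mat n n" and "j < n"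
  shows "(\<Sum>l<n. (B ^\<^sub>m Suc r) $$ (j, l)) = (\<Sum>k<n. B $$ (j, k) * (\<Sum>l<n. (B ^\<^sub>m r) $$ (k, l)))"
proof -
  have C: "B ^\<^sub>m r \<in> carrier_mat n n" using B by (rule pow_carrier_mat)
  have "(\<Sum>l<n. (B ^\<^sub>m Suc r) $$ (j, l)) = (\<Sum>l<n. \<Sum>k<n. B $$ (j, k) * (B ^\<^sub>m r) $$ (k, l))"
    unfolding pow_mat_Suc_left[OF B] using B C \<open>j < n\<close>
    by (simp add: scalar_prod_def lessThan_atLeast0)
  also have "\<dots> = (\<Sum>k<n. B $$ (j, k) * (\<Sum>l<n. (B ^\<^sub>m r) $$ (k, l)))"
    by (subst sum.swap) (simp add: sum_distrib_left)
  finally show ?thesis .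
qed

text \<open>Put \<open>t p j = \<phi> (x j * Q ^ p)\<close>. Expanding one factor \<open>Q\<close> and cutting between its two letters
  gives the vector equation \<open>t (p + 1) = (I + P) B (t p)\<close>, where \<open>I + P\<close> is the matrix of the second
  moments \<open>\<phi> (x j * x i)\<close>. Since \<open>P\<close> has rank one and \<open>\<phi> (Q ^ (p + 1))\<close> is \<open>c\<close> times the sum of the
  entries of \<open>B (t p)\<close>, the vector \<open>P B (t p)\<close> is constant with entries \<open>c * \<phi> (Q ^ (p + 1))\<close>; solving
  the resulting equation for \<open>t\<close> expresses it through the row sums of powers of \<open>B\<close>.\<close>

lemma (in nc_probability_space) quadratic_form_moment_recursion:
  assumes indep: "boolean_independent cscale \<phi> {..<n} x"
    and mean: "\<And>i. i < n \<Longrightarrow> \<phi> (x i) = c"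
    and variance: "\<And>i. i < n \<Longrightarrow> univariate_cumulant \<phi> 2 (x i) = 1"
    and c: "c\<^sup>2 = 1 / of_nat n"
    and A: "A \<in> carrier_mat n n" and diag: "\<And>i. i < n \<Longrightarrow> A $$ (i, i) = 0"
  defines "B \<equiv> (1 / of_nat n) \<cdot>\<^sub>m A" and "Q \<equiv> quadratic_form cscale n A x"
  shows "\<phi> (Q ^ Suc p) = (\<Sum>r\<le>p. \<omega> n (B ^\<^sub>m Suc r) * \<phi> (Q ^ (p - r)))"
proof -
  \<comment> \<open>\<open>R r\<close> is the vector of row sums of \<open>B ^ r\<close>, i.e. \<open>B ^ r\<close> applied to the all-ones vector.\<close>
  define R where "R r j = (\<Sum>l<n. (B ^\<^sub>m r) $$ (j, l))" for r j
  define t where "t p j = \<phi> (x j * Q ^ p)" for p j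
  have B: "B \<in> carrier_mat n n" using A by (simp add: B_def)
  have R_0: "R 0 j = 1" if "j < n" for j
    using that B by (simp add: R_def)
  have R_Suc: "R (Suc r) j = (\<Sum>k<n. B $$ (j, k) * R r k)" if "j < n" for r j
    unfolding R_def by (rule row_sum_pow_mat_Suc[OF B that])
  have \<omega>_R: "\<omega> n (B ^\<^sub>m r) = c\<^sup>2 * (\<Sum>j<n. R r j)" for r
    by (simp add: \<omega>_eq_mean_of_entries[OF pow_carrier_mat[OF B]] R_def c)
  have B_entry: "B $$ (i, k) = 1 / of_nat n * A $$ (i, k)" if "i < n" "k < n" for i k
    using that A by (simp add: B_def)
  have split: "\<phi> (prod_list (map x u) * x i * (x k * Q ^ p)) =
      \<phi> (prod_list (map x u) * x i) * t p k"
    if "i < n" "k < n" "i \<noteq> k" "set u \<subseteq> {..<n}" for u i k p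
  proof -
    have "x k \<in> word_span {..<n} x k" unfolding word_span_def
      using that by (intro span_base CollectI exI[of _ "[k]"]) auto
    then have "x k * Q ^ p \<in> word_span {..<n} x k"
      unfolding Q_def by (rule word_span_mult_quadratic_form)
    then show ?thesis
      using state_mult_word_span[OF indep, of "u @ [i]" k "x k * Q ^ p"] that
      by (simp add: t_def)
  qed
  have expand: "\<phi> (prod_list (map x u) * Q ^ Suc p) =
      (\<Sum>i<n. \<Sum>k<n. B $$ (i, k) * (\<phi> (prod_list (map x u) * x i) * t p k))"
    if "set u \<subseteq> {..<n}" for u p
  proof -
    have "\<phi> (prod_list (map x u) * Q ^ Suc p) =
      (\<Sum>i<n. \<Sum>k<n. (1 / of_nat n * A $$ (i, k)) * \<phi> (prod_list (map x u) * x i * (x k * Q ^ p)))"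
      using state_quadratic_form_between[OF diag,
        where z = "prod_list (map x u)" and x = x and y = "Q ^ p"]
      by (simp add: Q_def mult.assoc)
    also have "\<dots> = (\<Sum>i<n. \<Sum>k<n. B $$ (i, k) * (\<phi> (prod_list (map x u) * x i) * t p k))"
    proof (intro sum.cong refl)
      fix i k assume "i \<in> {..<n}" "k \<in> {..<n}"
      then show "(1 / of_nat n * A $$ (i, k)) * \<phi> (prod_list (map x u) * x i * (x k * Q ^ p)) =
          B $$ (i, k) * (\<phi> (prod_list (map x u) * x i) * t p k)"
        using split[of i k u p] that diag[of i] by (cases "i = k") (simp_all add: B_entry)
    qed
    finally show ?thesis .
  qed
  have gram: "\<phi> (x j * x i) = c\<^sup>2 + (if i = j then 1 else 0)" if "i < n" "j < n" for i j
  proof (cases "i = j")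
    case True
    then show ?thesis using state_square[OF mean variance] that by simp
  next
    case False
    then show ?thesis using state_mult_words[OF indep, of "[j]" "[i]"] that
      by (auto simp: mean power2_eq_square)
  qed
  have moment_t: "\<phi> (Q ^ Suc p) = c * (\<Sum>j<n. \<Sum>k<n. B $$ (j, k) * t p k)" for p
    using expand[of "[]" p] by (simp add: mean sum_distrib_left mult_ac del: power_Suc)
  have t_Suc: "t (Suc p) j = c * \<phi> (Q ^ Suc p) + (\<Sum>k<n. B $$ (j, k) * t p k)" if "j < n" for p j
  proof -
    have "t (Suc p) j = (\<Sum>i<n. \<Sum>k<n. B $$ (i, k) * (\<phi> (x j * x i) * t p k))"
      using expand[of "[j]" p] that by (simp add: t_def del: power_Suc)
    also have "\<dots> = (\<Sum>i<n. c\<^sup>2 * (\<Sum>k<n. B $$ (i, k) * t p k) +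
        (if i = j then \<Sum>k<n. B $$ (i, k) * t p k else 0))"
      using that by (intro sum.cong refl) (simp add: gram sum_distrib_left algebra_simps sum.distrib)
    also have "\<dots> = c * \<phi> (Q ^ Suc p) + (\<Sum>k<n. B $$ (j, k) * t p k)"
      unfolding moment_t using that
      by (simp add: sum.distrib sum_distrib_left power2_eq_square mult.assoc)
    finally show ?thesis .
  qed
  have t_eq: "t p j = (\<Sum>r\<le>p. c * \<phi> (Q ^ (p - r)) * R r j)" if "j < n" for p j
    using that
  proof (induction p arbitrary: j)
    case 0
    then show ?case by (simp add: t_def mean R_0 state_one)
  next
    case (Suc p)
    have "(\<Sum>k<n. B $$ (j, k) * t p k) = (\<Sum>k<n. \<Sum>r\<le>p. B $$ (j, k) * (c * \<phi> (Q ^ (p - r)) * R r k))"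
      by (simp add: Suc.IH sum_distrib_left)
    also have "\<dots> = (\<Sum>r\<le>p. c * \<phi> (Q ^ (p - r)) * R (Suc r) j)"
      using Suc.prems by (subst sum.swap) (simp add: R_Suc sum_distrib_left mult_ac)
    finally show ?case
      using Suc.prems by (simp add: t_Suc sum.atMost_Suc_shift R_0 del: sum.atMost_Suc power_Suc)
  qed
  have "(\<Sum>j<n. \<Sum>k<n. B $$ (j, k) * t p k) = (\<Sum>j<n. \<Sum>r\<le>p. c * \<phi> (Q ^ (p - r)) * R (Suc r) j)"
  proof (rule sum.cong[OF refl])
    fix j assume "j \<in> {..<n}"
    then have "t (Suc p) j = c * \<phi> (Q ^ Suc p) + (\<Sum>r\<le>p. c * \<phi> (Q ^ (p - r)) * R (Suc r) j)"
      by (simp add: t_eq sum.atMost_Suc_shift R_0 del: sum.atMost_Suc power_Suc)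
    then show "(\<Sum>k<n. B $$ (j, k) * t p k) = (\<Sum>r\<le>p. c * \<phi> (Q ^ (p - r)) * R (Suc r) j)"
      using t_Suc[of j p] \<open>j \<in> {..<n}\<close> by simp
  qed
  also have "\<dots> = (\<Sum>r\<le>p. c * \<phi> (Q ^ (p - r)) * (\<Sum>j<n. R (Suc r) j))"
    by (subst sum.swap) (simp add: sum_distrib_left)
  finally have "\<phi> (Q ^ Suc p) = c * (\<Sum>r\<le>p. c * \<phi> (Q ^ (p - r)) * (\<Sum>j<n. R (Suc r) j))"
    by (simp only: moment_t)
  also have "\<dots> = (\<Sum>r\<le>p. c\<^sup>2 * (\<Sum>j<n. R (Suc r) j) * \<phi> (Q ^ (p - r)))"
    by (subst sum_distrib_left) (simp add: power2_eq_square mult_ac)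
  finally show ?thesis by (simp only: \<omega>_R)
qed

section \<open>Positive functionals on polynomials are normal\<close>

definition poly_star :: "complex poly \<Rightarrow> complex poly" where
  "poly_star = map_poly cnj"

lemma poly_poly_star: "poly (poly_star p) z = cnj (poly p (cnj z))"
  by (simp add: poly_star_def)

lemma coeff_poly_star: "coeff (poly_star p) k = cnj (coeff p k)"
  by (simp add: poly_star_def coeff_map_poly)

lemma poly_star_mult: "poly_star (p * q) = poly_star p * poly_star q"
  by (simp add: poly_eq_iff coeff_poly_star coeff_mult)

lemma star_algebra_poly: "star_algebra Polynomial.smult poly_star"
proof unfold_locales
qed (auto simp: poly_star_mult smult_add_right smult_add_left mult.commute poly_eq_iff coeff_poly_star)

interpretation poly: star_algebra Polynomial.smult poly_star
  by (rule star_algebra_poly)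

definition nonneg_on_reals :: "complex poly \<Rightarrow> bool" where
  "nonneg_on_reals p \<longleftrightarrow> (\<forall>t::real. 0 \<le> poly p (of_real t))"

lemma poly_eqI_reals:
  fixes p q :: "complex poly"
  assumes "\<And>t::real. poly p (of_real t) = poly q (of_real t)"
  shows "p = q"
proof (rule poly_eqI_degree)
  let ?A = "complex_of_real ` real ` {..degree p + degree q}"
  show "poly p x = poly q x" if "x \<in> ?A" for x using that assms by auto
  have "card ?A = Suc (degree p + degree q)"
    by (subst card_image, simp add: inj_on_def)+ simp
  then show "degree p < card ?A" "degree q < card ?A" by auto
qed

lemma closed_nonneg_complex: "closed {z :: complex. 0 \<le> z}"
proof -
  have "{z :: complex. 0 \<le> z} = {z. 0 \<le> Re z} \<inter> {z. Im z = 0}"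
    by (auto simp: less_eq_complex_def)
  moreover have "closed {z :: complex. 0 \<le> Re z}" "closed {z :: complex. Im z = 0}"
    by (intro closed_Collect_le closed_Collect_eq continuous_intros)+
  ultimately show ?thesis by (simp add: closed_Int)
qed

lemma nonneg_at_right_limit:
  fixes f :: "real \<Rightarrow> complex"
  assumes "isCont f x" and "\<And>t. t > x \<Longrightarrow> 0 \<le> f t"
  shows "0 \<le> f x"
proof -
  have "(f \<longlongrightarrow> f x) (at_right x)"
    using assms(1) unfolding isCont_def by (rule tendsto_within_subset) simp
  moreover have "\<forall>\<^sub>F t in at_right x. f t \<in> {z. 0 \<le> z}"
    using assms(2) by (auto simp: eventually_at_right_field intro: exI[of _ "x + 1"])
  ultimately have "f x \<in> {z. 0 \<le> z}"
    by (intro Lim_in_closed_set[OF closed_nonneg_complex]) auto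
  then show ?thesis by simp
qed

lemma nonneg_on_reals_imp_self_adjoint:
  assumes "nonneg_on_reals p"
  shows "poly_star p = p"
proof (rule poly_eqI_reals)
  fix t :: real
  have "0 \<le> poly p (of_real t)" using assms by (simp add: nonneg_on_reals_def)
  then show "poly (poly_star p) (of_real t) = poly p (of_real t)"
    by (simp add: poly_poly_star less_eq_complex_def complex_eq_iff)
qed

text \<open>The Fejer-Riesz theorem for the real line. A root \<open>z\<close> comes with the root \<open>cnj z\<close>: if \<open>z\<close>
  is not real this is because the polynomial is self-adjoint, and if \<open>z\<close> is real then it is a double
  root because there is no change of sign. Splitting off both roots keeps the polynomial nonnegative
  and lowers the degree.\<close>

lemma nonneg_on_reals_imp_square:
  assumes "nonneg_on_reals p"
  shows "\<exists>q. p = poly_star q * q"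
  using assms
proof (induction "degree p" arbitrary: p rule: less_induct)
  case less
  have nonneg: "0 \<le> poly p (of_real t)" for t :: real
    using less.prems by (simp add: nonneg_on_reals_def)
  have self: "poly_star p = p"
    using less.prems by (rule nonneg_on_reals_imp_self_adjoint)
  show ?case
  proof (cases "degree p = 0")
    case True
    then obtain c where p: "p = [:c:]" by (rule degree_eq_zeroE)
    then have "0 \<le> c" using nonneg[of 0] by simp
    then have "c = of_real (sqrt (Re c)) * of_real (sqrt (Re c))"
      by (simp add: less_eq_complex_def complex_eq_iff)
    then have "p = poly_star [:of_real (sqrt (Re c)):] * [:of_real (sqrt (Re c)):]"
      by (simp add: p poly_eq_iff coeff_poly_star coeff_pCons split: nat.split)
    then show ?thesis by blast
  next
    case False
    then have "\<not> constant (poly p)" by (simp add: constant_degree)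
    then obtain z where "poly p z = 0" using fundamental_theorem_of_algebra by blast
    then obtain q where q: "p = [:-z, 1:] * q" by (auto simp: poly_eq_0_iff_dvd)
    have cont: "isCont (\<lambda>t::real. poly r (of_real t)) t" for r :: "complex poly" and t
      by (intro continuous_intros)
    have "poly q (cnj z) = 0"
    proof (cases "cnj z = z")
      case False
      have "poly p (cnj z) = 0"
        using \<open>poly p z = 0\<close> poly_poly_star[of p "cnj z"] by (simp add: self)
      then show ?thesis using False by (simp add: q)
    next
      case True
      then obtain x where z: "z = of_real x"
        by (metis Reals_cnj_iff Reals_cases)
      \<comment> \<open>The cofactor \<open>q\<close> is nonnegative to the right of \<open>x\<close> and nonpositive to the left.\<close>
      have factor: "poly p (of_real t) = of_real (t - x) * poly q (of_real t)" for t
        by (simp add: q z algebra_simps)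
      have "0 \<le> poly q (of_real x)"
      proof (rule nonneg_at_right_limit[where f = "\<lambda>t. poly q (of_real t)"])
        fix t assume "x < t"
        then show "0 \<le> poly q (of_real t)"
          using nonneg[of t] unfolding factor
          by (simp add: less_eq_complex_def zero_le_mult_iff)
      qed (rule cont)
      moreover have "0 \<le> - poly q (of_real (- (- x)))"
      proof (rule nonneg_at_right_limit[where f = "\<lambda>t. - poly q (of_real (- t))"])
        fix t assume "- x < t"
        then show "0 \<le> - poly q (of_real (- t))"
          using nonneg[of "- t"] unfolding factor
          by (simp add: less_eq_complex_def mult_le_0_iff zero_le_mult_iff)
      qed (intro continuous_intros)
      ultimately show ?thesis
        by (simp add: z less_eq_complex_def complex_eq_iff)
    qed
    then obtain r where r: "q = [:- cnj z, 1:] * r" by (auto simp: poly_eq_0_iff_dvd)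
    have star_factor: "poly_star [:- z, 1:] = [:- cnj z, 1:]"
      by (simp add: poly_eq_iff coeff_poly_star coeff_pCons split: nat.split)
    have poly_p: "poly p (of_real t) = of_real ((cmod (of_real t - z))\<^sup>2) * poly r (of_real t)" for t :: real
    proof -
      have "complex_of_real ((cmod (of_real t - z))\<^sup>2) = (of_real t - z) * (of_real t - cnj z)"
        by (subst complex_norm_square) simp
      then show ?thesis by (simp only: q r poly_mult mult_ac) (simp add: mult_ac)
    qed
    have off: "0 \<le> poly r (of_real t)" if "of_real t \<noteq> z" for t :: real
    proof -
      have "(cmod (of_real t - z))\<^sup>2 > 0" using that by simp
      then show ?thesis using nonneg[of t] unfolding poly_p
        by (simp add: less_eq_complex_def zero_le_mult_iff)
    qed
    have "nonneg_on_reals r"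
      unfolding nonneg_on_reals_def
    proof
      fix t :: real
      show "0 \<le> poly r (of_real t)"
      proof (cases "of_real t = z")
        case True
        show ?thesis
          by (rule nonneg_at_right_limit[where f = "\<lambda>t. poly r (of_real t)"])
             (use off True in \<open>auto intro!: cont\<close>)
      qed (rule off)
    qed
    moreover have "degree r < degree p"
    proof -
      have "p \<noteq> 0" using \<open>degree p \<noteq> 0\<close> by auto
      then have "r \<noteq> 0" "q \<noteq> 0" by (auto simp: q r)
      then show ?thesis unfolding q r by (simp add: degree_mult_eq del: mult_pCons_left)
    qed
    ultimately obtain s where "r = poly_star s * s" using less.hyps by blast
    then have "p = poly_star ([:- z, 1:] * s) * ([:- z, 1:] * s)"
      by (simp only: poly_star_mult star_factor q r mult_ac)
    then show ?thesis by blast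
  qed
qed

text \<open>Hence the order of the *-algebra of polynomials, which is defined through squares, is the
  pointwise order on the real line.\<close>

lemma positive_poly_iff: "poly.positive p \<longleftrightarrow> nonneg_on_reals p"
proof
  assume "poly.positive p"
  then obtain ys where p: "p = (\<Sum>y\<leftarrow>ys. poly_star y * y)" by (auto simp: poly.positive_def)
  have sq: "0 \<le> poly (poly_star y * y) (of_real t)" for y and t :: real
    by (simp add: poly_poly_star less_eq_complex_def)
  have "nonneg_on_reals (\<Sum>y\<leftarrow>ys. poly_star y * y)"
    using sq by (induction ys) (auto simp: nonneg_on_reals_def intro!: add_nonneg_nonneg)
  then show "nonneg_on_reals p" by (simp add: p)
next
  assume "nonneg_on_reals p"
  then obtain q where "p = poly_star q * q" using nonneg_on_reals_imp_square by blast
  then show "poly.positive p"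
    unfolding poly.positive_def by (intro exI[of _ "[q]"]) simp
qed

text \<open>This is what confines monotone families of polynomials to finite-dimensional spaces.\<close>

lemma degree_le_if_dominated:
  fixes p q :: "complex poly"
  assumes "nonneg_on_reals p" "nonneg_on_reals (q - p)"
  shows "degree p \<le> degree q"
proof (rule ccontr)
  assume "\<not> degree p \<le> degree q"
  then have "((\<lambda>z. poly q z / poly p z) \<longlongrightarrow> 0) at_infinity"
    by (intro poly_divide_tendsto_0_at_infinity) simp
  then obtain b where b: "\<And>z. norm z \<ge> b \<Longrightarrow> cmod (poly q z / poly p z) < 1"
    by (force simp: tendsto_iff eventually_at_infinity dest: spec[of _ 1])
  have "p \<noteq> 0" using \<open>\<not> degree p \<le> degree q\<close> by auto
  then have "finite {z. poly p z = 0}" by (rule poly_roots_finite)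
  then have "finite (complex_of_real -` {z. poly p z = 0})"
    by (rule finite_vimageI) (simp add: inj_on_def)
  then have "\<not> {\<bar>b\<bar>..} \<subseteq> complex_of_real -` {z. poly p z = 0}"
    using infinite_Ici finite_subset by blast
  then obtain t where t: "t \<ge> \<bar>b\<bar>" "poly p (of_real t) \<noteq> 0" by auto
  have "0 \<le> poly p (of_real t)" "poly p (of_real t) \<le> poly q (of_real t)"
    using assms by (auto simp: nonneg_on_reals_def)
  then have "cmod (poly p (of_real t)) \<le> cmod (poly q (of_real t))"
    by (simp add: less_eq_complex_def cmod_def)
  moreover have "cmod (poly q (of_real t)) < cmod (poly p (of_real t))"
    using b[of "of_real t"] t by (simp add: norm_divide divide_simps split: if_splits)
  ultimately show False by simp
qed

definition lagrange_basis :: "nat \<Rightarrow> nat \<Rightarrow> complex poly" where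
  "lagrange_basis N j = (\<Prod>i\<in>{..N} - {j}. Polynomial.smult (1 / (of_nat j - of_nat i)) [:- of_nat i, 1:])"

lemma poly_lagrange_basis:
  assumes "j \<le> N" "k \<le> N"
  shows "poly (lagrange_basis N j) (of_nat k) = (if j = k then 1 else 0)"
proof (cases "j = k")
  case True
  then show ?thesis
    by (auto simp: lagrange_basis_def poly_prod diff_divide_distrib[symmetric] intro!: prod.neutral)
next
  case False
  then have "k \<in> {..N} - {j}" using assms by auto
  then show ?thesis using False
    by (auto simp: lagrange_basis_def poly_prod intro!: prod_zero)
qed

lemma degree_lagrange_basis: "j \<le> N \<Longrightarrow> degree (lagrange_basis N j) \<le> N"
proof -
  assume "j \<le> N"
  have "degree (lagrange_basis N j) \<le> (\<Sum>i\<in>{..N} - {j}. 1)"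
    unfolding lagrange_basis_def
    by (rule degree_prod_sum_le[THEN order_trans]) (auto intro!: sum_mono)
  then show ?thesis using \<open>j \<le> N\<close> by simp
qed

text \<open>A linear functional on polynomials of degree at most \<open>N\<close> is thereby a combination of the
  values at \<open>0, \<dots>, N\<close>, so that convergence at these points implies convergence of every functional.\<close>

lemma lagrange_interpolation:
  assumes "degree p \<le> N"
  shows "p = (\<Sum>j\<le>N. Polynomial.smult (poly p (of_nat j)) (lagrange_basis N j))"
proof (rule poly_eqI_degree)
  let ?A = "(of_nat :: nat \<Rightarrow> complex) ` {..N}"
  have card: "card ?A = Suc N" by (subst card_image) (auto simp: inj_on_def)
  show "poly p x = poly (\<Sum>j\<le>N. Polynomial.smult (poly p (of_nat j)) (lagrange_basis N j)) x" if x: "x \<in> ?A" for x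
  proof -
    obtain k where k: "x = of_nat k" "k \<le> N" using x by blast
    have "poly (\<Sum>j\<le>N. Polynomial.smult (poly p (of_nat j)) (lagrange_basis N j)) x =
        (\<Sum>j\<le>N. if j = k then poly p (of_nat j) else 0)"
      unfolding poly_sum using k by (intro sum.cong refl) (simp add: poly_lagrange_basis)
    then show ?thesis using k by simp
  qed
  show "degree p < card ?A" using assms card by simp
  have "degree (\<Sum>j\<le>N. Polynomial.smult (poly p (of_nat j)) (lagrange_basis N j)) \<le> N"
    by (intro degree_sum_le) (auto intro: degree_lagrange_basis)
  then show "degree (\<Sum>j\<le>N. Polynomial.smult (poly p (of_nat j)) (lagrange_basis N j)) < card ?A"
    using card by simp
qed

lemma below_poly_iff: "poly.below p q \<longleftrightarrow> (\<forall>t::real. poly p (of_real t) \<le> poly q (of_real t))"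
  by (simp add: poly.below_def positive_poly_iff nonneg_on_reals_def)

text \<open>Let \<open>s\<close> be the supremum of \<open>D\<close>. Beyond a fixed element of \<open>D\<close> the gaps \<open>s - d\<close> have bounded
  degree and decrease, so they converge at the interpolation points, and hence under every linear
  functional, to their values at a polynomial \<open>f\<close>. Applied to evaluations, this shows that \<open>f\<close> is
  nonnegative and that \<open>s - f\<close> is an upper bound of \<open>D\<close>; thus \<open>f = 0\<close>. Applied to \<open>\<psi>\<close>, it then shows
  that \<open>\<psi> (s - d)\<close> becomes arbitrarily small.\<close>

lemma positive_functional_normal:
  fixes \<psi> :: "complex poly \<Rightarrow> complex"
  assumes add: "\<And>p q. \<psi> (p + q) = \<psi> p + \<psi> q"
    and scale: "\<And>c p. \<psi> (Polynomial.smult c p) = c * \<psi> p"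
    and pos: "\<And>p. 0 \<le> \<psi> (poly_star p * p)"
  shows "poly.normal \<psi>"
  unfolding poly.normal_def
proof (intro allI impI, elim conjE)
  fix D s
  assume D: "D \<noteq> {}"
    and directed: "\<forall>a\<in>D. \<forall>b\<in>D. \<exists>c\<in>D. poly.below a c \<and> poly.below b c"
    and sup: "poly.is_supremum D s"
  have s: "poly.self_adjoint s"
    and upper: "\<And>d. d \<in> D \<Longrightarrow> poly.below d s"
    and least: "\<And>u. poly.self_adjoint u \<Longrightarrow> (\<And>d. d \<in> D \<Longrightarrow> poly.below d u) \<Longrightarrow> poly.below s u"
    using sup by (auto simp: poly.is_supremum_def)
  have below_trans: "poly.below a c" if "poly.below a b" "poly.below b c" for a b c
    using that by (meson below_poly_iff order_trans)
  have diff: "\<psi> (p - q) = \<psi> p - \<psi> q" for p q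
    using add[of "p - q" q] by simp
  have mono: "\<psi> p \<le> \<psi> q" if pq: "poly.below p q" for p q
  proof -
    obtain r where "q - p = poly_star r * r"
      using nonneg_on_reals_imp_square[of "q - p"] pq
      by (auto simp: poly.below_def positive_poly_iff)
    then have "0 \<le> \<psi> q - \<psi> p" using pos[of r] diff[of q p] by simp
    then show ?thesis by simp
  qed
  obtain d0 where d0: "d0 \<in> D" using D by blast
  define D' where "D' = {d \<in> D. poly.below d0 d}"
  define N where "N = degree (s - d0)"
  have D'_ne: "d0 \<in> D'" using d0 by (simp add: D'_def below_poly_iff)
  have deg: "degree (s - d) \<le> N" if d: "d \<in> D'" for d
    unfolding N_def
  proof (rule degree_le_if_dominated)
    show "nonneg_on_reals (s - d)" "nonneg_on_reals (s - d0 - (s - d))"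
      using d upper[of d] by (auto simp: D'_def poly.below_def positive_poly_iff)
  qed
  define gap where "gap d j = Re (poly (s - d) (of_nat j))" for d j
  have gap: "poly (s - d) (of_nat j) = of_real (gap d j)" "0 \<le> gap d j" if d: "d \<in> D" for d j
  proof -
    have "0 \<le> poly (s - d) (of_real (real j))"
      using upper[OF d, unfolded below_poly_iff, THEN spec, of "real j"] by simp
    then show "poly (s - d) (of_nat j) = of_real (gap d j)" "0 \<le> gap d j"
      by (simp_all add: gap_def less_eq_complex_def complex_eq_iff)
  qed
  have gap_antimono: "gap d' j \<le> gap d j" if d: "poly.below d d'" for d d' j
  proof -
    have "poly d (of_real (real j)) \<le> poly d' (of_real (real j))"
      using d unfolding below_poly_iff by blast
    then show ?thesis by (simp add: gap_def less_eq_complex_def)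
  qed
  define v where "v j = (INF d\<in>D'. gap d j)" for j
  have bdd: "bdd_below ((\<lambda>d. gap d j) ` D')" for j
    using gap(2) by (intro bdd_belowI[of _ 0]) (auto simp: D'_def)
  have v_le: "v j \<le> gap d j" if "d \<in> D'" for d j
    unfolding v_def using bdd that by (rule cINF_lower)
  have near: "\<exists>d\<in>D'. gap d j < v j + e" if e: "e > 0" for e j
    using cINF_less_iff[OF _ bdd, of j "v j + e"] D'_ne e by (auto simp: v_def)
  \<comment> \<open>Directedness makes one element good at finitely many points at once.\<close>
  have all_near: "\<exists>d\<in>D'. \<forall>j<M. gap d j < v j + e" if e: "e > 0" for e M
  proof (induction M)
    case 0
    then show ?case using D'_ne by blast
  next
    case (Suc M)
    then obtain d where d: "d \<in> D'" "\<forall>j<M. gap d j < v j + e" by blast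
    obtain d' where d': "d' \<in> D'" "gap d' M < v M + e" using near[OF e] by blast
    obtain c where c: "c \<in> D" "poly.below d c" "poly.below d' c"
      using directed d(1) d'(1) by (auto simp: D'_def)
    have "c \<in> D'" using c d(1) below_trans by (auto simp: D'_def)
    moreover have "gap c j < v j + e" if j: "j < Suc M" for j
      using j d d' gap_antimono[OF c(2)] gap_antimono[OF c(3)]
      by (metis less_Suc_eq order_le_less_trans)
    ultimately show ?case by blast
  qed
  define f where "f = (\<Sum>j\<le>N. Polynomial.smult (of_real (v j)) (lagrange_basis N j))"
  have approx: "\<exists>d'\<in>D'. poly.below d d' \<and> dist (L (s - d')) (L f) < e"
    if L_add: "\<And>p q. L (p + q) = L p + L q" and L_scale: "\<And>c p. L (Polynomial.smult c p) = c * L p"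
      and e: "e > 0" and d: "d \<in> D" for L :: "complex poly \<Rightarrow> complex" and e d
  proof -
    have L_0: "L 0 = 0" using L_scale[of 0 0] by simp
    have L_sum: "L (\<Sum>j\<in>J. g j) = (\<Sum>j\<in>J. L (g j))" for J :: "nat set" and g
      by (induction J rule: infinite_finite_induct) (auto simp: L_0 L_add)
    define S where "S = (\<Sum>j\<le>N. cmod (L (lagrange_basis N j)))"
    have S: "S \<ge> 0" by (simp add: S_def sum_nonneg)
    \<comment> \<open>\<open>S\<close> may be 0, hence the \<open>+ 1\<close>.\<close>
    define e' where "e' = e / (S + 1)"
    have e': "e' > 0" using e S by (simp add: e'_def)
    obtain c where c: "c \<in> D'" "\<forall>j<Suc N. gap c j < v j + e'" using all_near[OF e'] by blast
    obtain d' where d': "d' \<in> D" "poly.below c d'" "poly.below d d'"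
      using directed c(1) d by (auto simp: D'_def)
    have "d' \<in> D'" using d' c(1) below_trans by (auto simp: D'_def)
    have small: "\<bar>gap d' j - v j\<bar> \<le> e'" if "j \<le> N" for j
    proof -
      have "gap d' j \<le> gap c j" "gap c j < v j + e'" "v j \<le> gap d' j"
        using gap_antimono[OF d'(2)] c(2) v_le[OF \<open>d' \<in> D'\<close>] that by auto
      then show ?thesis by linarith
    qed
    have "L (s - d') = (\<Sum>j\<le>N. of_real (gap d' j) * L (lagrange_basis N j))"
      by (subst lagrange_interpolation[OF deg[OF \<open>d' \<in> D'\<close>]]) (simp only: L_sum L_scale gap(1)[OF d'(1)])
    then have "L (s - d') - L f = (\<Sum>j\<le>N. of_real (gap d' j - v j) * L (lagrange_basis N j))"
      by (simp add: f_def L_sum L_scale algebra_simps flip: sum_subtractf)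
    also have "cmod \<dots> \<le> (\<Sum>j\<le>N. e' * cmod (L (lagrange_basis N j)))"
      by (intro sum_norm_le) (auto simp: norm_mult simp del: of_real_diff intro!: mult_right_mono small)
    also have "\<dots> = e' * S" by (simp add: S_def sum_distrib_left)
    also have "\<dots> < e' * (S + 1)" using e' by simp
    also have "\<dots> = e" using S by (simp add: e'_def)
    finally have "dist (L (s - d')) (L f) < e" by (simp add: dist_norm)
    then show ?thesis using \<open>d' \<in> D'\<close> d'(3) by blast
  qed
  have approx_at: "\<exists>d'\<in>D'. poly.below d d' \<and> dist (poly (s - d') (of_real t)) (poly f (of_real t)) < e"
    if "e > 0" "d \<in> D" for e d and t :: real
    using that by (intro approx) auto
  have f_nonneg: "nonneg_on_reals f"
    unfolding nonneg_on_reals_def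
  proof
    fix t :: real
    have "\<exists>w\<in>{z. 0 \<le> z}. dist w (poly f (of_real t)) < e" if e: "e > 0" for e
    proof -
      obtain d' where "d' \<in> D'" "dist (poly (s - d') (of_real t)) (poly f (of_real t)) < e"
        using approx_at[OF e d0] by blast
      moreover from this have "0 \<le> poly (s - d') (of_real t)"
        using upper[of d'] by (auto simp: D'_def below_poly_iff)
      ultimately show ?thesis by blast
    qed
    then show "0 \<le> poly f (of_real t)"
      using closed_approachable[OF closed_nonneg_complex] by blast
  qed
  have f_le: "poly.below d (s - f)" if d: "d \<in> D" for d
    unfolding below_poly_iff
  proof
    fix t :: real
    have "\<exists>w\<in>{z. 0 \<le> z}. dist w (poly (s - f - d) (of_real t)) < e" if e: "e > 0" for e
    proof -
      obtain d' where d': "d' \<in> D'" "poly.below d d'"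
          "dist (poly (s - d') (of_real t)) (poly f (of_real t)) < e"
        using approx_at[OF e d] by blast
      have "0 \<le> poly (d' - d) (of_real t)" using d'(2) by (simp add: below_poly_iff)
      moreover have "poly (d' - d) (of_real t) - poly (s - f - d) (of_real t) =
          - (poly (s - d') (of_real t) - poly f (of_real t))" by simp
      then have "dist (poly (d' - d) (of_real t)) (poly (s - f - d) (of_real t)) < e"
        using d'(3) by (simp only: dist_norm norm_minus_cancel)
      ultimately show ?thesis by blast
    qed
    then have "0 \<le> poly (s - f - d) (of_real t)"
      using closed_approachable[OF closed_nonneg_complex] by blast
    then show "poly d (of_real t) \<le> poly (s - f) (of_real t)" by simp
  qed
  have "poly.self_adjoint (s - f)"
    using s nonneg_on_reals_imp_self_adjoint[OF f_nonneg]
    by (simp add: poly.self_adjoint_def poly_eq_iff coeff_poly_star)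
  then have "poly.below s (s - f)" using f_le by (rule least)
  then have "poly f (of_real t) = 0" for t :: real
    using f_nonneg by (auto simp: below_poly_iff nonneg_on_reals_def intro: antisym)
  then have "f = 0" by (intro poly_eqI_reals) simp
  have "\<exists>d\<in>D. Re (\<psi> s) - e < Re (\<psi> d)" if e: "e > 0" for e
  proof -
    obtain d where d: "d \<in> D'" "dist (\<psi> (s - d)) (\<psi> f) < e"
      using approx[of \<psi> e d0] add scale e d0 by blast
    have "\<psi> f = 0" using \<open>f = 0\<close> scale[of 0 0] by simp
    then have "\<bar>Re (\<psi> s - \<psi> d)\<bar> < e"
      using d(2) abs_Re_le_cmod[of "\<psi> s - \<psi> d"] by (simp add: dist_norm diff)
    then show ?thesis using d(1) by (auto simp: D'_def intro!: bexI[of _ d])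
  qed
  moreover have le: "Re (\<psi> d) \<le> Re (\<psi> s)" if "d \<in> D" for d
    using mono[OF upper[OF that]] by (simp add: less_eq_complex_def)
  ultimately show "(SUP d\<in>D. Re (\<psi> d)) = Re (\<psi> s)"
  proof (intro antisym cSUP_least D le)
    assume near: "\<And>e. e > 0 \<Longrightarrow> \<exists>d\<in>D. Re (\<psi> s) - e < Re (\<psi> d)"
    show "Re (\<psi> s) \<le> (SUP d\<in>D. Re (\<psi> d))"
    proof (rule field_le_epsilon)
      fix e :: real assume "e > 0"
      then obtain d where "d \<in> D" "Re (\<psi> s) - e < Re (\<psi> d)" using near by blast
      moreover have "Re (\<psi> d) \<le> (SUP d\<in>D. Re (\<psi> d))"
        using \<open>d \<in> D\<close> le by (intro cSUP_upper bdd_aboveI[of _ "Re (\<psi> s)"]) auto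
      ultimately show "Re (\<psi> s) \<le> (SUP d\<in>D. Re (\<psi> d)) + e" by linarith
    qed
  qed
qed

section \<open>The functional with given moments\<close>

definition moment_functional :: "(nat \<Rightarrow> complex) \<Rightarrow> complex poly \<Rightarrow> complex" where
  "moment_functional M p = (\<Sum>k\<le>degree p. coeff p k * M k)"

lemma moment_functional_eq:
  assumes "degree p \<le> N"
  shows "moment_functional M p = (\<Sum>k\<le>N. coeff p k * M k)"
  unfolding moment_functional_def using assms
  by (intro sum.mono_neutral_left) (auto simp: coeff_eq_0)

lemma moment_functional_add: "moment_functional M (p + q) = moment_functional M p + moment_functional M q"
proof -
  let ?N = "max (degree p) (degree q)"
  have "moment_functional M (p + q) = (\<Sum>k\<le>?N. coeff (p + q) k * M k)"
    by (intro moment_functional_eq degree_add_le) auto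
  then show ?thesis
    by (simp add: moment_functional_eq[of p ?N] moment_functional_eq[of q ?N] distrib_right sum.distrib)
qed

lemma moment_functional_smult: "moment_functional M (Polynomial.smult c p) = c * moment_functional M p"
  by (subst moment_functional_eq[OF degree_smult_le])
     (simp add: moment_functional_def sum_distrib_left mult.assoc)

lemma moment_functional_monom: "moment_functional M (monom c k) = c * M k"
proof -
  have "moment_functional M (monom c k) = (\<Sum>j\<le>k. coeff (monom c k) j * M j)"
    by (intro moment_functional_eq degree_monom_le)
  also have "\<dots> = (\<Sum>j\<le>k. if j = k then c * M j else 0)"
    by (intro sum.cong) auto
  finally show ?thesis by simp
qed

lemma moment_functional_x_power: "moment_functional M ([:0, 1:] ^ k) = M k"
  using moment_functional_monom[of M 1 k] by (simp add: monom_altdef)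

lemma moment_functional_square:
  "moment_functional M (poly_star p * p) =
    (\<Sum>i\<le>degree p. \<Sum>j\<le>degree p. cnj (coeff p i) * coeff p j * M (i + j))"
proof -
  have sum: "moment_functional M (\<Sum>i\<in>I. g i) = (\<Sum>i\<in>I. moment_functional M (g i))" for I :: "nat set" and g
    using moment_functional_smult[of M 0 0]
    by (induction I rule: infinite_finite_induct) (auto simp: moment_functional_add)
  have "poly_star p = (\<Sum>i\<le>degree p. monom (cnj (coeff p i)) i)"
    using poly_as_sum_of_monoms'[of "poly_star p" "degree p"]
    by (simp add: coeff_poly_star) (simp add: poly_star_def degree_map_poly_le)
  then have "poly_star p * p =
      (\<Sum>i\<le>degree p. monom (cnj (coeff p i)) i) * (\<Sum>j\<le>degree p. monom (coeff p j) j)"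
    by (simp only: poly_as_sum_of_monoms)
  then show ?thesis
    by (simp add: sum_product mult_monom sum moment_functional_monom)
qed

text \<open>The positivity condition says that all Hankel matrices of the sequence \<open>M\<close> are positive
  semidefinite.\<close>

lemma nc_probability_space_moment_functional:
  assumes "M 0 = 1"
    and "\<And>c N. 0 \<le> (\<Sum>i\<le>N. \<Sum>j\<le>N. cnj (c i) * c j * M (i + j))"
  shows "nc_probability_space Polynomial.smult poly_star (moment_functional M)"
proof -
  have pos: "0 \<le> moment_functional M (poly_star p * p)" for p
    unfolding moment_functional_square by (rule assms(2))
  interpret V: vector_space "(*) :: complex \<Rightarrow> complex \<Rightarrow> complex"
    by unfold_locales (auto simp: algebra_simps)
  show ?thesis
  proof unfold_locales
    show "moment_functional M 1 = 1"
      using moment_functional_x_power[of M 0] assms(1) by simp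
    show "poly.normal (moment_functional M)"
      by (rule positive_functional_normal[OF moment_functional_add moment_functional_smult pos])
    show "0 \<le> moment_functional M (poly_star p * p)" for p by (rule pos)
  qed (auto simp: moment_functional_add moment_functional_smult algebra_simps)
qed

section \<open>Convergence of the quadratic forms\<close>

context nc_probability_space
begin

interpretation state: Vector_Spaces.linear cscale "(*)" \<phi>
  by (rule state_linear)

lemma star_sum: "star (\<Sum>i\<in>I. f i) = (\<Sum>i\<in>I. star (f i))"
proof -
  have "star 0 = 0" using star_add[of 0 0] by simp
  then show ?thesis by (induction I rule: infinite_finite_induct) (simp_all add: star_add)
qed

lemma self_adjoint_power:
  assumes "self_adjoint x"
  shows "star (x ^ k) = x ^ k"
proof (induction k)
  case 0
  have "star 1 = 1" using star_mult[of "star 1" 1] star_star[of 1] by simp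
  then show ?case by simp
next
  case (Suc k)
  then show ?case using assms
    by (simp add: star_mult self_adjoint_def power_commutes)
qed

lemma moment_matrix_nonneg:
  assumes "self_adjoint x"
  shows "0 \<le> (\<Sum>i\<le>N. \<Sum>j\<le>N. cnj (c i) * c j * \<phi> (x ^ (i + j)))"
proof -
  define y where "y = (\<Sum>i\<le>N. cscale (c i) (x ^ i))"
  have "star y = (\<Sum>i\<le>N. cscale (cnj (c i)) (x ^ i))"
    by (simp add: y_def star_sum star_cscale self_adjoint_power[OF assms])
  then have "\<phi> (star y * y) = (\<Sum>i\<le>N. \<Sum>j\<le>N. cnj (c i) * c j * \<phi> (x ^ (i + j)))"
    by (simp add: y_def sum_product cscale_mult_left cscale_mult_right state.sum state.scale
        power_add mult.assoc mult.left_commute)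
  then show ?thesis using state_positive[of y] by simp
qed

lemma self_adjoint_quadratic_form:
  assumes x: "\<And>i. i < n \<Longrightarrow> self_adjoint (x i)"
    and A: "A \<in> carrier_mat n n" "mat_adjoint A = A"
  shows "self_adjoint (quadratic_form cscale n A x)"
proof -
  let ?S = "{(i, j). i < n \<and> j < n \<and> i \<noteq> j}"
  have entry: "cnj (A $$ (i, j)) = A $$ (j, i)" if "i < n" "j < n" for i j
  proof -
    have "mat_adjoint A $$ (j, i) = cnj (A $$ (i, j))"
      using A(1) that by (simp add: mat_adjoint_def mat_of_rows_index cols_nth)
    then show ?thesis using A(2) by simp
  qed
  have "star (\<Sum>(i, j)\<in>?S. cscale (A $$ (i, j)) (x i * x j)) =
      (\<Sum>(i, j)\<in>?S. cscale (A $$ (j, i)) (x j * x i))"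
    unfolding star_sum
    by (intro sum.cong refl)
       (use x in \<open>auto simp: star_cscale star_mult entry self_adjoint_def\<close>)
  also have "\<dots> = (\<Sum>(i, j)\<in>?S. cscale (A $$ (i, j)) (x i * x j))"
    by (rule sum.reindex_bij_witness[of _ prod.swap prod.swap]) auto
  finally show ?thesis
    by (simp add: self_adjoint_def quadratic_form_def star_cscale)
qed

end

theorem theorem5p1:
  fixes cscale :: "complex \<Rightarrow> 'a::ring_1 \<Rightarrow> 'a"
    and star :: "'a \<Rightarrow> 'a"
    and \<phi> :: "'a \<Rightarrow> complex"
    and A :: "nat \<Rightarrow> complex mat"
    and X :: "nat \<Rightarrow> nat \<Rightarrow> 'a"
    and \<mu> :: "real measure"
  assumes space: "nc_probability_space cscale star \<phi>"
    and A_carrier: "\<And>n. A n \<in> carrier_mat n n"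
    and A_self_adjoint: "\<And>n. mat_adjoint (A n) = A n"
    and A_diagonal: "\<And>n i. i < n \<Longrightarrow> A n $$ (i, i) = 0"
    and A_bounded: "\<exists>C. \<forall>n. \<forall>i<n. \<forall>j<n. cmod (A n $$ (i, j)) \<le> C"
    and A_limit: "has_limit_distribution (\<lambda>n. (1 / of_nat n) \<cdot>\<^sub>m A n) \<mu>"
    and X_random_variable: "\<And>n i. i < n \<Longrightarrow> nc_probability_space.random_variable star (X n i)"
    and X_identically_distributed: "identically_distributed \<phi> X"
    and X_independent: "\<And>n. boolean_independent cscale \<phi> {..<n} (X n)"
    and X_mean: "\<And>n i. i < n \<Longrightarrow> \<phi> (X n i) = complex_of_real (1 / sqrt (real n))"
    and X_variance: "\<And>n i. i < n \<Longrightarrow> univariate_cumulant \<phi> 2 (X n i) = 1"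
    and product: "product_formula \<phi>"
  shows "\<exists>cscale' star' (\<psi> :: complex poly \<Rightarrow> complex) Y.
      nc_probability_space cscale' star' \<psi> \<and>
      nc_probability_space.random_variable star' Y \<and>
      (\<forall>r\<ge>1. univariate_cumulant \<psi> r Y = complex_of_real (\<integral>t. t ^ r \<partial>\<mu>)) \<and>
      converges_in_distribution \<phi> (\<lambda>n. quadratic_form cscale n (A n) (X n)) \<psi> Y"
proof -
  interpret nc_probability_space cscale star \<phi> by (rule space)
  define Q where "Q n = quadratic_form cscale n (A n) (X n)" for n
  define k where "k r = complex_of_real (\<integral>t. t ^ r \<partial>\<mu>)" for r :: nat
  define M where "M m = lim (\<lambda>n. \<phi> (Q n ^ m))" for m
  have k: "(\<lambda>n. \<omega> n (((1 / of_nat n) \<cdot>\<^sub>m A n) ^\<^sub>m Suc r)) \<longlonglongrightarrow> k (Suc r)" for r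
    using A_limit unfolding has_limit_distribution_def k_def by auto
  have rec: "\<phi> (Q n ^ Suc m) =
      (\<Sum>r\<le>m. \<omega> n (((1 / of_nat n) \<cdot>\<^sub>m A n) ^\<^sub>m Suc r) * \<phi> (Q n ^ (m - r)))" for n m
  proof -
    have c: "(complex_of_real (1 / sqrt (real n)))\<^sup>2 = 1 / of_nat n"
      by (simp add: power_divide flip: of_real_power)
    show ?thesis unfolding Q_def
      by (rule quadratic_form_moment_recursion[OF X_independent X_mean X_variance c A_carrier A_diagonal])
  qed
  \<comment> \<open>One induction yields both that the moments converge and that the limits inherit the recursion;
    \<open>M\<close> is meaningful only once convergence is known.\<close>
  have step: "(\<lambda>n. \<phi> (Q n ^ Suc m)) \<longlonglongrightarrow> (\<Sum>r\<le>m. k (Suc r) * M (m - r))"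
    if "\<And>j. j \<le> m \<Longrightarrow> (\<lambda>n. \<phi> (Q n ^ j)) \<longlonglongrightarrow> M j" for m
    unfolding rec by (intro tendsto_sum tendsto_mult k that) auto
  have M: "(\<lambda>n. \<phi> (Q n ^ m)) \<longlonglongrightarrow> M m" for m
  proof (induction m rule: less_induct)
    case (less m)
    have "convergent (\<lambda>n. \<phi> (Q n ^ m))"
    proof (cases m)
      case 0
      then show ?thesis by (simp add: convergent_const)
    next
      case (Suc p)
      then show ?thesis unfolding Suc using less.IH Suc by (intro convergentI[OF step]) auto
    qed
    then show ?case by (simp add: M_def convergent_LIMSEQ_iff)
  qed
  have M_rec: "M (Suc m) = (\<Sum>r\<le>m. k (Suc r) * M (m - r))" for m
    using LIMSEQ_unique[OF M step[OF M]] .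
  have M_0: "M 0 = 1"
    using LIMSEQ_unique[OF M[of 0]] by (simp add: state_one)
  have Q_self_adjoint: "self_adjoint (Q n)" for n
    using X_random_variable unfolding Q_def random_variable_def
    by (intro self_adjoint_quadratic_form A_carrier A_self_adjoint) auto
  have M_nonneg: "0 \<le> (\<Sum>i\<le>N. \<Sum>j\<le>N. cnj (c i) * c j * M (i + j))" for c N
  proof -
    have "(\<lambda>n. \<Sum>i\<le>N. \<Sum>j\<le>N. cnj (c i) * c j * \<phi> (Q n ^ (i + j))) \<longlonglongrightarrow>
        (\<Sum>i\<le>N. \<Sum>j\<le>N. cnj (c i) * c j * M (i + j))"
      by (intro tendsto_sum tendsto_mult_left M)
    then have "(\<Sum>i\<le>N. \<Sum>j\<le>N. cnj (c i) * c j * M (i + j)) \<in> {z. 0 \<le> z}"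
      using moment_matrix_nonneg[OF Q_self_adjoint]
      by (intro Lim_in_closed_set[OF closed_nonneg_complex]) (auto intro!: always_eventually)
    then show ?thesis by simp
  qed
  define \<psi> where "\<psi> = moment_functional M"
  define Y where "Y = ([:0, 1:] :: complex poly)"
  have moments: "\<psi> (Y ^ m) = M m" for m
    by (simp only: \<psi>_def Y_def moment_functional_x_power)
  have \<psi>: "nc_probability_space Polynomial.smult poly_star \<psi>"
    unfolding \<psi>_def using M_0 M_nonneg by (rule nc_probability_space_moment_functional)
  moreover have "nc_probability_space.random_variable poly_star Y"
    unfolding nc_probability_space.random_variable_def[OF \<psi>] poly.self_adjoint_def
    by (simp add: Y_def poly_eq_iff coeff_poly_star coeff_pCons split: nat.split)
  moreover have "univariate_cumulant \<psi> r Y = k r" if "r \<ge> 1" for r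
    using nc_probability_space.state_one[OF \<psi>] _ that
  proof (rule univariate_cumulant_unique)
    show "\<psi> (Y ^ Suc m) = (\<Sum>r\<le>m. k (Suc r) * \<psi> (Y ^ (m - r)))" for m
      by (simp only: moments M_rec)
  qed
  moreover have "converges_in_distribution \<phi> Q \<psi> Y"
    using M by (simp add: converges_in_distribution_def moments)
  ultimately show ?thesis
    unfolding k_def Q_def by blast
qed

end
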